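(* Let $a>0$, $b\ge0$, $c\ge0$ and let $T$ be the semi-infinite tetradiagonal Toeplitz matrix with all entries of the first superdiagonal equal to $1$, of the diagonal equal to $c$, of the first subdiagonal equal to $b$, of the second subdiagonal equal to $a$, and all other entries zero. Then $T$ is oscillatory if and only if $T$ admits a positive bidiagonal factorization (PBF).
   Context: A finite real matrix is totally nonnegative (TN) if all its minors are nonnegative, and oscillatory if it is TN and some power of it has all minors positive (equivalently, TN, irreducible and nonsingular). A semi-infinite matrix is called oscillatory if all its leading principal submatrices are oscillatory. A PBF of a semi-infinite matrix $T$ is a factorization $T=L_1L_2U$ where $L_1$ is lower unitriangular bidiagonal with first subdiagonal $(\alpha_2,\alpha_5,\alpha_8,\dots)$, $L_2$ is lower unitriangular bidiagonal with first subdiagonal $(\alpha_3,\alpha_6,\alpha_9,\dots)$, $U$ is upper bidiagonal with diagonal $(\alpha_1,\alpha_4,\alpha_7,\dots)$ and first superdiagonal of ones, and $\alpha_j>0$ for all $j\in\mathbb N$. *)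

theory Defs
  imports
    Complex_Main
    "HOL-Library.Groups_Big_Fun"
    "Jordan_Normal_Form.Determinant"
    "Jordan_Normal_Form.DL_Submatrix"
begin

definition all_minors :: "(real \<Rightarrow> bool) \<Rightarrow> real mat \<Rightarrow> bool" where
  "all_minors P A \<longleftrightarrow>
     (\<forall>I J. I \<subseteq> {..<dim_row A} \<longrightarrow> J \<subseteq> {..<dim_col A} \<longrightarrow> I \<noteq> {} \<longrightarrow> card I = card J \<longrightarrow>
        P (det (submatrix A I J)))"

definition totally_nonnegative :: "real mat \<Rightarrow> bool" where
  "totally_nonnegative A \<longleftrightarrow> all_minors (\<lambda>x. 0 \<le> x) A"

definition totally_positive :: "real mat \<Rightarrow> bool" where
  "totally_positive A \<longleftrightarrow> all_minors (\<lambda>x. 0 < x) A"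

text \<open>The exponent has to be at least 1: the zeroth power of the zero matrix of size one
  is totally positive.\<close>

definition oscillatory_mat :: "real mat \<Rightarrow> bool" where
  "oscillatory_mat A \<longleftrightarrow>
     square_mat A \<and> totally_nonnegative A \<and> (\<exists>k\<ge>1. totally_positive (A ^\<^sub>m k))"

text \<open>Rows and columns of semi-infinite matrices are numbered from 0.\<close>

type_synonym semi_inf_mat = "nat \<Rightarrow> nat \<Rightarrow> real"

definition leading_principal :: "semi_inf_mat \<Rightarrow> nat \<Rightarrow> real mat" where
  "leading_principal T n = mat n n (\<lambda>(i, j). T i j)"

definition oscillatory :: "semi_inf_mat \<Rightarrow> bool" where
  "oscillatory T \<longleftrightarrow> (\<forall>n\<ge>1. oscillatory_mat (leading_principal T n))"

text \<open>\<^const>\<open>Sum_any\<close> sums over the support and is 0 if the support is infinite. The support is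
  finite whenever each row of the left factor has finitely many nonzero entries, which is
  the case for all products of banded matrices.\<close>

definition semi_inf_times :: "semi_inf_mat \<Rightarrow> semi_inf_mat \<Rightarrow> semi_inf_mat" where
  "semi_inf_times A B = (\<lambda>i j. Sum_any (\<lambda>k. A i k * B k j))"

definition lower_unitri_bidiag :: "(nat \<Rightarrow> real) \<Rightarrow> semi_inf_mat" where
  "lower_unitri_bidiag s = (\<lambda>i j. if i = j then 1 else if i = j + 1 then s j else 0)"

definition upper_bidiag :: "(nat \<Rightarrow> real) \<Rightarrow> semi_inf_mat" where
  "upper_bidiag d = (\<lambda>i j. if i = j then d i else if j = i + 1 then 1 else 0)"

text \<open>The sequence \<open>\<alpha>\<close> is numbered from 1; its value at 0 is irrelevant.\<close>

definition is_PBF :: "(nat \<Rightarrow> real) \<Rightarrow> semi_inf_mat \<Rightarrow> bool" where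
  "is_PBF \<alpha> T \<longleftrightarrow>
     (\<forall>j\<ge>1. 0 < \<alpha> j) \<and>
     T = semi_inf_times
           (semi_inf_times (lower_unitri_bidiag (\<lambda>k. \<alpha> (3 * k + 2)))
                           (lower_unitri_bidiag (\<lambda>k. \<alpha> (3 * k + 3))))
           (upper_bidiag (\<lambda>k. \<alpha> (3 * k + 1)))"

definition admits_PBF :: "semi_inf_mat \<Rightarrow> bool" where
  "admits_PBF T \<longleftrightarrow> (\<exists>\<alpha>. is_PBF \<alpha> T)"

definition tetradiag_toeplitz :: "real \<Rightarrow> real \<Rightarrow> real \<Rightarrow> semi_inf_mat" where
  "tetradiag_toeplitz a b c = (\<lambda>i j.
     if j = i + 1 then 1
     else if i = j then c
     else if i = j + 1 then b
     else if i = j + 2 then a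
     else 0)"

end

theory Submission
  imports Defs
begin

text \<open>
  If \<open>T\<close> is oscillatory, let \<open>h n\<close> be its leading principal minors, which are positive. By the
  Desnanot--Jacobi identity \<open>(h (n + 1))\<^sup>2 - h n * h (n + 2)\<close> is the minor of \<open>T\<close> in rows
  \<open>1, \<dots>, n + 1\<close> and columns \<open>0, \<dots>, n\<close>, so \<open>h\<close> is log-concave and \<open>h (n + 1) / h n\<close> decreases to a
  limit \<open>r\<close>, which is a positive root of \<open>x\<^sup>3 - c x\<^sup>2 + b x - a\<close>. Write this cubic as
  \<open>(x - r) (x\<^sup>2 - q x + p)\<close>. Then \<open>g (n + 1) = h (n + 1) - r * h n\<close> is nonnegative and satisfies the
  recurrence of \<open>x\<^sup>2 - q x + p\<close> with \<open>p > 0\<close>, which forces it to be positive. A PBF can be written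
  down explicitly in terms of \<open>r\<close>, \<open>p\<close>, \<open>g\<close> and \<open>h\<close>.

  Conversely, every minor of a bidiagonal matrix is the product of the diagonal entries of the
  submatrix, so by the Cauchy--Binet formula a product of positive bidiagonal matrices is totally
  nonnegative and has positive minors between index sets that differ by one downward or one
  upward step. Any two index sets of the same size are joined by such steps, hence some power of
  the product is totally positive.
\<close>

section \<open>Minors and the Cauchy--Binet formula\<close>

text \<open>Rows and columns are selected by maps rather than sets, since the proof of the
  Cauchy--Binet formula passes through selections that are unordered or repeat a row.\<close>

definition minor :: "'a :: comm_ring_1 mat \<Rightarrow> nat \<Rightarrow> (nat \<Rightarrow> nat) \<Rightarrow> (nat \<Rightarrow> nat) \<Rightarrow> 'a" where
  "minor A k f g = det (mat k k (\<lambda>(i, j). A $$ (f i, g j)))"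

lemma minor_leibniz:
  "minor A k f g = (\<Sum>p | p permutes {0..<k}. signof p * (\<Prod>i=0..<k. A $$ (f i, g (p i))))"
proof -
  have "p i < k" if "p permutes {0..<k}" "i < k" for p i
    using permutes_in_image[OF that(1), of i] that(2) by simp
  then show ?thesis
    unfolding minor_def by (subst det_def'[of _ k]) (auto intro!: sum.cong prod.cong)
qed

lemma minor_cong:
  assumes "\<And>i. i < k \<Longrightarrow> f i = f' i" and "\<And>i. i < k \<Longrightarrow> g i = g' i"
  shows "minor A k f g = minor A k f' g'"
  unfolding minor_def by (rule arg_cong[where f = det], rule eq_matI) (auto simp: assms)

lemma minor_permute_rows:
  assumes p: "p permutes {0..<k}"
  shows "minor A k (\<lambda>i. f (p i)) g = signof p * minor A k f g"
proof -
  have "p i < k" if "i < k" for i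
    using permutes_in_image[OF p, of i] that by simp
  then have "mat k k (\<lambda>(i, j). A $$ (f (p i), g j))
      = mat k k (\<lambda>(i, j). mat k k (\<lambda>(i, j). A $$ (f i, g j)) $$ (p i, j))"
    by (intro eq_matI) auto
  then show ?thesis
    unfolding minor_def by (simp add: det_permute_rows[OF _ p])
qed

lemma minor_eq_0_if_not_inj:
  assumes "\<not> inj_on f {0..<k}"
  shows "minor A k f g = 0"
proof -
  obtain i j where ij: "i < k" "j < k" "i \<noteq> j" "f i = f j"
    using assms by (auto simp: inj_on_def)
  show ?thesis
    unfolding minor_def
    by (rule det_identical_rows[of _ k i j]) (use ij in \<open>auto intro!: eq_vecI\<close>)
qed

lemma pick_bij_betw:
  assumes "finite K" and "card K = k"
  shows "bij_betw (pick K) {0..<k} K"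
proof -
  have "strict_mono_on {0..<k} (pick K)"
    using assms by (auto intro!: strict_mono_onI pick_mono_le)
  then have inj: "inj_on (pick K) {0..<k}"
    by (rule strict_mono_on_imp_inj_on)
  have sub: "pick K ` {0..<k} \<subseteq> K"
    using assms by (auto intro: pick_in_set_le)
  have "pick K ` {0..<k} = K"
    by (rule card_subset_eq[OF assms(1) sub]) (simp add: card_image[OF inj] assms(2))
  with inj show ?thesis by (simp add: bij_betw_def)
qed

text \<open>An injection of \<open>{0..<k}\<close> onto \<open>K\<close> is the enumeration
  \<open>pick K\<close> after a unique permutation. The hypothesis \<open>ext\<close> lets
  \<open>w\<close> ignore values outside \<open>{0..<k}\<close>, where the two kinds of maps
  differ.\<close>

lemma sum_inj_fun_with_range:
  assumes K: "finite K" "card K = k"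
    and ext: "\<And>\<phi> \<psi>. (\<And>i. i < k \<Longrightarrow> \<phi> i = \<psi> i) \<Longrightarrow> w \<phi> = w \<psi>"
  shows "(\<Sum>\<phi> | \<phi> \<in> {0..<k} \<rightarrow>\<^sub>E M \<and> inj_on \<phi> {0..<k} \<and> \<phi> ` {0..<k} = K. w \<phi>)
    = (\<Sum>p | p permutes {0..<k} \<and> K \<subseteq> M. w (\<lambda>i. pick K (p i)))"
proof -
  let ?U = "{0..<k}"
  note bij = pick_bij_betw[OF K]
  have inj: "inj_on (pick K) ?U" and img: "pick K ` ?U = K"
    using bij by (auto simp: bij_betw_def)
  let ?i = "\<lambda>\<phi> i. if i < k then inv_into ?U (pick K) (\<phi> i) else i"
  let ?j = "\<lambda>p. restrict (\<lambda>i. pick K (p i)) ?U"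
  show ?thesis
  proof (rule sum.reindex_bij_witness[of _ ?j ?i])
    fix \<phi> assume \<phi>: "\<phi> \<in> {\<phi> \<in> ?U \<rightarrow>\<^sub>E M. inj_on \<phi> ?U \<and> \<phi> ` ?U = K}"
    then have mem: "\<phi> i \<in> K" if "i < k" for i using that by auto
    have pk: "pick K (?i \<phi> i) = \<phi> i" if "i < k" for i
      using mem[OF that] that img by (simp add: f_inv_into_f)
    show "?j (?i \<phi>) = \<phi>"
      using \<phi> pk by (auto simp: PiE_def extensional_def restrict_def fun_eq_iff)
    have "bij_betw (inv_into ?U (pick K)) K ?U"
      by (rule bij_betw_inv_into[OF bij])
    moreover have "bij_betw \<phi> ?U K" using \<phi> by (auto simp: bij_betw_def)
    ultimately have "bij_betw (inv_into ?U (pick K) \<circ> \<phi>) ?U ?U"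
      by (rule bij_betw_trans[rotated])
    then have "bij_betw (?i \<phi>) ?U ?U"
      by (rule bij_betw_cong[THEN iffD1, rotated]) auto
    then have "?i \<phi> permutes ?U"
      by (rule bij_imp_permutes) auto
    moreover have "K \<subseteq> M" using \<phi> by auto
    ultimately show "?i \<phi> \<in> {p. p permutes ?U \<and> K \<subseteq> M}" by blast
    show "w (\<lambda>i. pick K (?i \<phi> i)) = w \<phi>"
      by (rule ext) (rule pk)
  next
    fix p assume "p \<in> {p. p permutes ?U \<and> K \<subseteq> M}"
    then have p: "p permutes ?U" and KM: "K \<subseteq> M" by auto
    have less: "p i < k" if "i < k" for i
      using permutes_in_image[OF p, of i] that by simp
    show "?i (?j p) = p"
      using less permutes_not_in[OF p] inj by (auto simp: fun_eq_iff inv_into_f_f)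
    have "bij_betw (pick K \<circ> p) ?U K"
      by (rule bij_betw_trans[OF permutes_imp_bij[OF p] bij])
    then have "bij_betw (?j p) ?U K"
      by (rule bij_betw_cong[THEN iffD1, rotated]) auto
    then show "?j p \<in> {\<phi> \<in> ?U \<rightarrow>\<^sub>E M. inj_on \<phi> ?U \<and> \<phi> ` ?U = K}"
      using KM by (auto simp: bij_betw_def)
  qed
qed

text \<open>Multiplying out the Leibniz formula picks an inner index \<open>\<phi> i\<close> for
  each row. Choices that repeat an index contribute nothing; those with the same range
  \<open>K\<close> differ by a permutation, whose sign completes the minor of
  \<open>A\<close>.\<close>

lemma cauchy_binet:
  fixes A B :: "'a :: comm_ring_1 mat"
  assumes A: "A \<in> carrier_mat n m" and B: "B \<in> carrier_mat m r"
    and f: "\<And>i. i < k \<Longrightarrow> f i < n" and g: "\<And>i. i < k \<Longrightarrow> g i < r"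
  shows "minor (A * B) k f g
    = (\<Sum>K | K \<subseteq> {0..<m} \<and> card K = k. minor A k f (pick K) * minor B k (pick K) g)"
proof -
  let ?U = "{0..<k}" and ?M = "{0..<m}"
  let ?P = "{p. p permutes ?U}" and ?F = "?U \<rightarrow>\<^sub>E ?M"
  let ?T = "{K. K \<subseteq> ?M \<and> card K = k}"
  define w where "w \<phi> = (\<Prod>i\<in>?U. A $$ (f i, \<phi> i)) * minor B k \<phi> g" for \<phi>
  have finF: "finite ?F" by (rule finite_PiE) auto
  have "minor (A * B) k f g
      = (\<Sum>p\<in>?P. signof p * (\<Prod>i\<in>?U. \<Sum>l\<in>?M. A $$ (f i, l) * B $$ (l, g (p i))))"
    unfolding minor_leibniz
  proof (intro sum.cong refl arg_cong2[where f = "(*)"] prod.cong)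
    fix p i assume p: "p \<in> ?P" and i: "i \<in> ?U"
    have "p i < k" using permutes_in_image[of p ?U i] p i by simp
    then show "(A * B) $$ (f i, g (p i)) = (\<Sum>l\<in>?M. A $$ (f i, l) * B $$ (l, g (p i)))"
      using A B f g i by (auto simp: scalar_prod_def intro!: sum.cong)
  qed
  also have "\<dots> = (\<Sum>p\<in>?P. \<Sum>\<phi>\<in>?F.
      (\<Prod>i\<in>?U. A $$ (f i, \<phi> i)) * (signof p * (\<Prod>i\<in>?U. B $$ (\<phi> i, g (p i)))))"
    by (subst prod_sum_PiE) (auto simp: sum_distrib_left prod.distrib algebra_simps)
  \<comment> \<open>For fixed \<phi>, the sum over \<open>p\<close> is the Leibniz formula for the
    rows \<phi> of \<open>B\<close>.\<close>
  also have "\<dots> = (\<Sum>\<phi>\<in>?F. w \<phi>)"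
    by (subst sum.swap) (simp add: w_def minor_leibniz sum_distrib_left)
  also have "\<dots> = (\<Sum>\<phi> | \<phi> \<in> ?F \<and> inj_on \<phi> ?U. w \<phi>)"
    by (rule sum.mono_neutral_right[OF finF]) (auto simp: w_def minor_eq_0_if_not_inj)
  also have "\<dots> = (\<Sum>K\<in>?T. \<Sum>\<phi> | \<phi> \<in> {\<phi>. \<phi> \<in> ?F \<and> inj_on \<phi> ?U} \<and> \<phi> ` ?U = K. w \<phi>)"
  proof (rule sum.group[symmetric])
    show "finite {\<phi>. \<phi> \<in> ?F \<and> inj_on \<phi> ?U}" using finF by auto
    show "finite ?T" by auto
    show "(\<lambda>\<phi>. \<phi> ` ?U) ` {\<phi>. \<phi> \<in> ?F \<and> inj_on \<phi> ?U} \<subseteq> ?T"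
      by (auto simp: card_image)
  qed
  also have "\<dots> = (\<Sum>K\<in>?T. minor A k f (pick K) * minor B k (pick K) g)"
  proof (rule sum.cong[OF refl])
    fix K assume K: "K \<in> ?T"
    then have fin: "finite K" and card: "card K = k" and sub: "K \<subseteq> ?M"
      by (auto intro: finite_subset)
    have "(\<Sum>\<phi> | \<phi> \<in> {\<phi>. \<phi> \<in> ?F \<and> inj_on \<phi> ?U} \<and> \<phi> ` ?U = K. w \<phi>)
        = (\<Sum>p | p permutes ?U \<and> K \<subseteq> ?M. w (\<lambda>i. pick K (p i)))"
      unfolding mem_Collect_eq conj_assoc
    proof (rule sum_inj_fun_with_range[OF fin card])
      fix \<phi> \<psi> :: "nat \<Rightarrow> nat" assume "\<And>i. i < k \<Longrightarrow> \<phi> i = \<psi> i"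
      then show "w \<phi> = w \<psi>"
        unfolding w_def by (intro arg_cong2[where f = "(*)"] prod.cong minor_cong) auto
    qed
    also have "\<dots> = (\<Sum>p\<in>?P. (signof p * (\<Prod>i\<in>?U. A $$ (f i, pick K (p i)))) * minor B k (pick K) g)"
      using sub by (intro sum.cong) (auto simp: w_def minor_permute_rows)
    also have "\<dots> = minor A k f (pick K) * minor B k (pick K) g"
      by (simp add: minor_leibniz[of A] sum_distrib_right)
    finally show "(\<Sum>\<phi> | \<phi> \<in> {\<phi>. \<phi> \<in> ?F \<and> inj_on \<phi> ?U} \<and> \<phi> ` ?U = K. w \<phi>)
        = minor A k f (pick K) * minor B k (pick K) g" .
  qed
  finally show ?thesis .
qed

text \<open>These maps encode the \<open>k\<close>-element subsets of \<open>{0..<n}\<close>;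
  \<open>pick\<close> and the image are the two translations.\<close>

definition increasing_index :: "nat \<Rightarrow> nat \<Rightarrow> (nat \<Rightarrow> nat) \<Rightarrow> bool" where
  "increasing_index k n f \<longleftrightarrow> strict_mono_on {0..<k} f \<and> (\<forall>i<k. f i < n)"

lemma increasing_index_less: "increasing_index k n f \<Longrightarrow> i < k \<Longrightarrow> f i < n"
  by (simp add: increasing_index_def)

lemma increasing_index_mono: "increasing_index k n f \<Longrightarrow> i < j \<Longrightarrow> j < k \<Longrightarrow> f i < f j"
  by (auto simp: increasing_index_def strict_mono_on_def)

lemma increasing_index_ge: "increasing_index k n f \<Longrightarrow> i < k \<Longrightarrow> i \<le> f i"
proof (induction i)
  case (Suc i)
  then have "f i < f (Suc i)" and "i \<le> f i"
    by (auto intro: increasing_index_mono)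
  then show ?case by simp
qed simp

lemma increasing_index_pick:
  assumes "K \<subseteq> {0..<n}" and "card K = k"
  shows "increasing_index k n (pick K)"
proof -
  have "pick K i < n" if "i < k" for i
    using pick_in_set_le[of i K] that assms by auto
  moreover have "strict_mono_on {0..<k} (pick K)"
    using assms by (auto intro!: strict_mono_onI pick_mono_le)
  ultimately show ?thesis by (simp add: increasing_index_def)
qed

text \<open>Exactly \<open>i\<close> elements of the image lie below \<open>f i\<close>, namely the
  values of \<open>f\<close> at arguments below \<open>i\<close>.\<close>

lemma pick_image_increasing_index:
  assumes f: "increasing_index k n f" and i: "i < k"
  shows "pick (f ` {0..<k}) i = f i"
proof -
  have inj: "inj_on f {0..<k}"
    using f strict_mono_on_imp_inj_on by (auto simp: increasing_index_def)
  have "{a \<in> f ` {0..<k}. a < f i} = f ` {0..<i}"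
  proof (intro equalityI subsetI)
    fix a assume "a \<in> {a \<in> f ` {0..<k}. a < f i}"
    then obtain j where j: "j < k" "a = f j" "f j < f i" by auto
    then have "j < i"
      using increasing_index_mono[OF f, of i j] by (metis linorder_neqE_nat order_less_asym)
    then show "a \<in> f ` {0..<i}" using j by auto
  next
    fix a assume "a \<in> f ` {0..<i}"
    then show "a \<in> {a \<in> f ` {0..<k}. a < f i}"
      using increasing_index_mono[OF f] i by auto
  qed
  moreover have "card (f ` {0..<i}) = i"
    using inj i by (subst card_image) (auto elim: inj_on_subset)
  ultimately show ?thesis
    using pick_card_in_set[of "f i" "f ` {0..<k}"] i by simp
qed

text \<open>\<open>submatrix\<close> enumerates its index sets by \<open>pick\<close>, so minors
  indexed by sets are minors along increasing maps.\<close>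

lemma all_minorsI:
  assumes A: "A \<in> carrier_mat n n"
    and P: "\<And>k f g. increasing_index k n f \<Longrightarrow> increasing_index k n g \<Longrightarrow> P (minor A k f g)"
  shows "all_minors P A"
  unfolding all_minors_def
proof (intro allI impI)
  fix I J assume IJ: "I \<subseteq> {..<dim_row A}" "J \<subseteq> {..<dim_col A}" "card I = card J"
  have "{i. i < dim_row A \<and> i \<in> I} = I" "{j. j < dim_col A \<and> j \<in> J} = J"
    using IJ by auto
  then have "det (submatrix A I J) = minor A (card I) (pick I) (pick J)"
    using IJ by (simp add: submatrix_def minor_def)
  moreover have "increasing_index (card I) n (pick I)" "increasing_index (card I) n (pick J)"
    using IJ A by (auto intro!: increasing_index_pick)
  ultimately show "P (det (submatrix A I J))" using P by simp
qed

lemma all_minorsD: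
  assumes "all_minors P A" and A: "A \<in> carrier_mat n n" and "0 < k"
    and f: "increasing_index k n f" and g: "increasing_index k n g"
  shows "P (minor A k f g)"
proof -
  let ?U = "{0..<k}"
  have card: "card (f ` ?U) = k" "card (g ` ?U) = k"
    using f g by (auto simp: increasing_index_def card_image strict_mono_on_imp_inj_on)
  have sub: "f ` ?U \<subseteq> {..<n}" "g ` ?U \<subseteq> {..<n}"
    using f g by (auto simp: increasing_index_def)
  have "{i. i < n \<and> i \<in> f ` ?U} = f ` ?U" "{i. i < n \<and> i \<in> g ` ?U} = g ` ?U"
    using sub by auto
  then have "det (submatrix A (f ` ?U) (g ` ?U)) = minor A k (pick (f ` ?U)) (pick (g ` ?U))"
    using A card by (simp add: submatrix_def minor_def)
  also have "\<dots> = minor A k f g"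
    by (rule minor_cong) (use f g in \<open>auto simp: pick_image_increasing_index\<close>)
  finally have "det (submatrix A (f ` ?U) (g ` ?U)) = minor A k f g" .
  moreover have "P (det (submatrix A (f ` ?U) (g ` ?U)))"
    using assms(1) unfolding all_minors_def
    by (rule allE[of _ "f ` ?U"], elim allE[of _ "g ` ?U"])
       (use A sub card \<open>0 < k\<close> in auto)
  ultimately show ?thesis by simp
qed

lemma cauchy_binet_increasing:
  fixes A B :: "'a :: comm_ring_1 mat"
  assumes A: "A \<in> carrier_mat n n" and B: "B \<in> carrier_mat n n"
    and f: "increasing_index k n f" and g: "increasing_index k n g"
  shows "minor (A * B) k f g
    = (\<Sum>K | K \<subseteq> {0..<n} \<and> card K = k. minor A k f (pick K) * minor B k (pick K) g)"
  by (rule cauchy_binet[OF A B])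
     (auto intro: increasing_index_less[OF f] increasing_index_less[OF g])

lemma minor_mult_nonneg:
  fixes A B :: "'a :: linordered_idom mat"
  assumes A: "A \<in> carrier_mat n n" and B: "B \<in> carrier_mat n n"
    and posA: "\<And>h. increasing_index k n h \<Longrightarrow> 0 \<le> minor A k f h"
    and posB: "\<And>h. increasing_index k n h \<Longrightarrow> 0 \<le> minor B k h g"
    and f: "increasing_index k n f" and g: "increasing_index k n g"
  shows "0 \<le> minor (A * B) k f g"
  unfolding cauchy_binet_increasing[OF A B f g]
proof (rule sum_nonneg)
  fix K assume "K \<in> {K. K \<subseteq> {0..<n} \<and> card K = k}"
  then have "increasing_index k n (pick K)" by (auto intro: increasing_index_pick)
  then show "0 \<le> minor A k f (pick K) * minor B k (pick K) g"
    by (intro mult_nonneg_nonneg posA posB)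
qed

text \<open>No term of the Cauchy--Binet sum is negative, and the term of the range of
  \<open>h\<close> is positive. Thus \<open>h\<close> acts as an intermediate stop on a path from
  \<open>f\<close> to \<open>g\<close>.\<close>

lemma minor_mult_pos:
  fixes A B :: "'a :: linordered_idom mat"
  assumes A: "A \<in> carrier_mat n n" and B: "B \<in> carrier_mat n n"
    and posA: "\<And>h. increasing_index k n h \<Longrightarrow> 0 \<le> minor A k f h"
    and posB: "\<And>h. increasing_index k n h \<Longrightarrow> 0 \<le> minor B k h g"
    and f: "increasing_index k n f" and g: "increasing_index k n g" and h: "increasing_index k n h"
    and "0 < minor A k f h" and "0 < minor B k h g"
  shows "0 < minor (A * B) k f g"
proof -
  let ?K = "h ` {0..<k}"
  have "card ?K = k"
    using h by (auto simp: increasing_index_def card_image strict_mono_on_imp_inj_on)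
  moreover have "?K \<subseteq> {0..<n}"
    using h by (auto simp: increasing_index_def)
  moreover have "minor A k f (pick ?K) = minor A k f h" "minor B k (pick ?K) g = minor B k h g"
    by (auto intro!: minor_cong simp: pick_image_increasing_index[OF h])
  moreover have "0 \<le> minor A k f (pick K) * minor B k (pick K) g"
    if "K \<in> {K. K \<subseteq> {0..<n} \<and> card K = k}" for K
  proof -
    have "increasing_index k n (pick K)" using that by (auto intro: increasing_index_pick)
    then show ?thesis by (intro mult_nonneg_nonneg posA posB)
  qed
  ultimately show ?thesis
    unfolding cauchy_binet_increasing[OF A B f g]
    using assms(8,9) by (intro sum_pos2[of _ ?K]) auto
qed

section \<open>Minors of staircase matrices\<close>

lemma strict_mono_permutes_eq_id:
  assumes p: "p permutes {0..<k}" and mono: "strict_mono_on {0..<k} (p :: nat \<Rightarrow> nat)"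
  shows "p = id"
\<comment> \<open>An increasing map on \<open>{0..<k}\<close> dominates the identity, and a
  permutation that does so is the identity.\<close>
proof (rule permutes_natset_ge[OF p], intro ballI)
  fix i assume "i \<in> {0..<k}"
  moreover have "increasing_index k k p"
    using mono permutes_in_image[OF p] by (auto simp: increasing_index_def)
  ultimately show "i \<le> p i" by (auto intro: increasing_index_ge)
qed

text \<open>A permutation with a nonzero term in the Leibniz expansion has to be monotone here.\<close>

lemma minor_staircase:
  assumes f: "increasing_index k n f" and g: "increasing_index k n g"
    and staircase: "\<And>i i' j j'. i < i' \<Longrightarrow> i' < n \<Longrightarrow> j < n \<Longrightarrow> j' < n \<Longrightarrow>
      A $$ (i, j) \<noteq> 0 \<Longrightarrow> A $$ (i', j') \<noteq> 0 \<Longrightarrow> j \<le> j'"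
  shows "minor A k f g = (\<Prod>i=0..<k. A $$ (f i, g i))"
proof -
  let ?P = "{p. p permutes {0..<k}}"
  have "(\<Prod>i=0..<k. A $$ (f i, g (p i))) = 0" if p: "p permutes {0..<k}" and "p \<noteq> id" for p
  proof (rule ccontr)
    assume "\<not> ?thesis"
    then have nz: "A $$ (f i, g (p i)) \<noteq> 0" if "i < k" for i
      using that by (metis atLeast0LessThan finite_lessThan lessThan_iff prod_zero)
    have less: "p i < k" if "i < k" for i
      using permutes_in_image[OF p, of i] that by simp
    have "strict_mono_on {0..<k} p"
    proof (rule strict_mono_onI)
      fix i j assume ij: "i \<in> {0..<k}" "j \<in> {0..<k}" "i < j"
      then have "g (p i) \<le> g (p j)"
        using less[of i] less[of j]
        by (intro staircase[of "f i" "f j"] nz)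
           (auto intro: increasing_index_less[OF f] increasing_index_less[OF g]
              increasing_index_mono[OF f])
      then have "p i \<le> p j"
        using increasing_index_mono[OF g, of "p j" "p i"] less ij by fastforce
      moreover have "p i \<noteq> p j"
        using permutes_inj[OF p] ij by (metis injD less_irrefl)
      ultimately show "p i < p j" by simp
    qed
    with p \<open>p \<noteq> id\<close> strict_mono_permutes_eq_id show False by blast
  qed
  then have "minor A k f g = (\<Sum>p\<in>{id}. signof p * (\<Prod>i=0..<k. A $$ (f i, g (p i))))"
    unfolding minor_leibniz
    by (intro sum.mono_neutral_right) (auto simp: permutes_id finite_permutations)
  then show ?thesis by simp
qed

lemma minor_one_mat:
  assumes f: "increasing_index k n f"
  shows "minor (1\<^sub>m n) k f f = 1"
  by (subst minor_staircase[OF f f])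
     (auto simp: increasing_index_less[OF f] split: if_splits intro!: prod.neutral)

section \<open>Products of positive bidiagonal matrices\<close>

abbreviation lower_section :: "(nat \<Rightarrow> real) \<Rightarrow> nat \<Rightarrow> real mat" where
  "lower_section s n \<equiv> leading_principal (lower_unitri_bidiag s) n"

abbreviation upper_section :: "(nat \<Rightarrow> real) \<Rightarrow> nat \<Rightarrow> real mat" where
  "upper_section d n \<equiv> leading_principal (upper_bidiag d) n"

lemma leading_principal_carrier [simp]: "leading_principal T n \<in> carrier_mat n n"
  by (simp add: leading_principal_def)

text \<open>Two adjacent diagonals form a staircase: a nonzero entry in a lower row is never to the
  left of one in a higher row.\<close>

lemma minor_lower_section:
  assumes f: "increasing_index k n f" and g: "increasing_index k n g"
  shows "minor (lower_section s n) k f g = (\<Prod>i=0..<k. lower_unitri_bidiag s (f i) (g i))"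
  by (subst minor_staircase[OF f g])
     (auto simp: leading_principal_def lower_unitri_bidiag_def
        increasing_index_less[OF f] increasing_index_less[OF g] split: if_splits intro!: prod.cong)

lemma minor_upper_section:
  assumes f: "increasing_index k n f" and g: "increasing_index k n g"
  shows "minor (upper_section d n) k f g = (\<Prod>i=0..<k. upper_bidiag d (f i) (g i))"
  by (subst minor_staircase[OF f g])
     (auto simp: leading_principal_def upper_bidiag_def
        increasing_index_less[OF f] increasing_index_less[OF g] split: if_splits intro!: prod.cong)

locale positive_bidiagonals =
  fixes s t d :: "nat \<Rightarrow> real" and n :: nat
  assumes s_pos: "0 < s i" and t_pos: "0 < t i" and d_pos: "0 < d i"
begin

definition M :: "real mat" where
  "M = lower_section s n * lower_section t n * upper_section d n"

lemma M_carrier [simp]: "M \<in> carrier_mat n n"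
  unfolding M_def by (intro mult_carrier_mat[of _ n n] leading_principal_carrier)

lemma lower_lower_carrier [simp]: "lower_section s n * lower_section t n \<in> carrier_mat n n"
  by (intro mult_carrier_mat[of _ n n] leading_principal_carrier)

context
  fixes k :: nat and f g :: "nat \<Rightarrow> nat"
  assumes f: "increasing_index k n f" and g: "increasing_index k n g"
begin

lemma lower_nonneg:
  "0 \<le> minor (lower_section s n) k f g" "0 \<le> minor (lower_section t n) k f g"
  unfolding minor_lower_section[OF f g]
  using less_imp_le[OF s_pos] less_imp_le[OF t_pos]
  by (auto simp: lower_unitri_bidiag_def intro!: prod_nonneg)

lemma lower_pos:
  assumes "\<And>i. i < k \<Longrightarrow> f i = g i \<or> f i = g i + 1"
  shows "0 < minor (lower_section s n) k f g" "0 < minor (lower_section t n) k f g"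
  unfolding minor_lower_section[OF f g]
  using assms s_pos t_pos by (force simp: lower_unitri_bidiag_def intro!: prod_pos)+

lemma upper_nonneg: "0 \<le> minor (upper_section d n) k f g"
  unfolding minor_upper_section[OF f g]
  using less_imp_le[OF d_pos] by (auto simp: upper_bidiag_def intro!: prod_nonneg)

lemma upper_pos:
  assumes "\<And>i. i < k \<Longrightarrow> g i = f i \<or> g i = f i + 1"
  shows "0 < minor (upper_section d n) k f g"
  unfolding minor_upper_section[OF f g]
  using assms d_pos by (force simp: upper_bidiag_def intro!: prod_pos)

end

lemma lower_lower_nonneg:
  assumes f: "increasing_index k n f" and g: "increasing_index k n g"
  shows "0 \<le> minor (lower_section s n * lower_section t n) k f g"
  using f g by (intro minor_mult_nonneg[where n = n] lower_nonneg) auto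

lemma lower_lower_pos:
  assumes f: "increasing_index k n f" and g: "increasing_index k n g"
    and "\<And>i. i < k \<Longrightarrow> f i = g i \<or> f i = g i + 1"
  shows "0 < minor (lower_section s n * lower_section t n) k f g"
  using assms by (intro minor_mult_pos[where n = n and h = g] lower_nonneg lower_pos) auto

lemma M_nonneg:
  assumes f: "increasing_index k n f" and g: "increasing_index k n g"
  shows "0 \<le> minor M k f g"
  unfolding M_def
  using f g by (intro minor_mult_nonneg[where n = n] lower_lower_nonneg upper_nonneg) auto

text \<open>The lower factors make the step, and the upper factor contributes its principal minor at
  \<open>g\<close>.\<close>

lemma M_pos_down:
  assumes f: "increasing_index k n f" and g: "increasing_index k n g"
    and "\<And>i. i < k \<Longrightarrow> f i = g i \<or> f i = g i + 1"
  shows "0 < minor M k f g"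
  unfolding M_def using assms
  by (intro minor_mult_pos[where n = n and h = g] lower_lower_nonneg lower_lower_pos upper_nonneg upper_pos) auto

text \<open>The lower factors contribute their principal minor at \<open>f\<close>, and the upper
  factor makes the step.\<close>

lemma M_pos_up:
  assumes f: "increasing_index k n f" and g: "increasing_index k n g"
    and "\<And>i. i < k \<Longrightarrow> g i = f i \<or> g i = f i + 1"
  shows "0 < minor M k f g"
  unfolding M_def using assms
  by (intro minor_mult_pos[where n = n and h = f] lower_lower_nonneg lower_lower_pos upper_nonneg upper_pos) auto

lemma M_pow_nonneg:
  assumes f: "increasing_index k n f" and g: "increasing_index k n g"
  shows "0 \<le> minor (M ^\<^sub>m m) k f g"
  using g
proof (induction m arbitrary: g)
  case 0
  have "minor (1\<^sub>m n) k f g = (\<Prod>i=0..<k. 1\<^sub>m n $$ (f i, g i) :: real)"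
    by (rule minor_staircase[OF f 0]) (auto split: if_splits)
  also have "\<dots> \<ge> 0"
    using f 0 by (intro prod_nonneg) (auto simp: increasing_index_less)
  finally show ?case using M_carrier by (simp del: M_carrier add: carrier_matD[of M n n])
next
  case (Suc m)
  then show ?case
    using f by (auto intro!: minor_mult_nonneg[where n = n] M_nonneg pow_carrier_mat)
qed

lemma M_pow_pos_step:
  assumes f: "increasing_index k n f" and h: "increasing_index k n h" and g: "increasing_index k n g"
    and "0 < minor (M ^\<^sub>m m) k f h" and "0 < minor M k h g"
  shows "0 < minor (M ^\<^sub>m Suc m) k f g"
  using assms by (auto intro!: minor_mult_pos[where n = n and h = h] M_nonneg M_pow_nonneg pow_carrier_mat)

text \<open>The position after \<open>m\<close> downward steps: each index descends by one per step
  until it reaches \<open>q\<close>, the least value possible at place \<open>q\<close> of an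
  increasing map.\<close>

definition lowered :: "nat \<Rightarrow> (nat \<Rightarrow> nat) \<Rightarrow> nat \<Rightarrow> nat" where
  "lowered m f q = max q (f q - m)"

lemma increasing_index_lowered:
  assumes f: "increasing_index k n f"
  shows "increasing_index k n (lowered m f)"
proof -
  have "strict_mono_on {0..<k} (lowered m f)"
  proof (rule strict_mono_onI)
    fix i j assume "i \<in> {0..<k}" "j \<in> {0..<k}" "i < j"
    moreover from this have "f i < f j" using increasing_index_mono[OF f] by simp
    ultimately show "lowered m f i < lowered m f j" by (auto simp: lowered_def max_def)
  qed
  moreover have "lowered m f i < n" if "i < k" for i
    using increasing_index_less[OF f that] increasing_index_ge[OF f that] by (auto simp: lowered_def)
  ultimately show ?thesis by (simp add: increasing_index_def)
qed

text \<open>One more lowering moves every index by at most one, which a single further factor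
  \<open>M\<close> covers by \<open>M_pos_down\<close>.\<close>

lemma M_pow_pos_lowered:
  assumes f: "increasing_index k n f"
  shows "0 < minor (M ^\<^sub>m m) k f (lowered m f)"
proof (induction m)
  case 0
  have "minor (1\<^sub>m n) k f (lowered 0 f) = (minor (1\<^sub>m n) k f f :: real)"
    using increasing_index_ge[OF f] by (intro minor_cong) (auto simp: lowered_def)
  also have "\<dots> = 1" by (rule minor_one_mat[OF f])
  finally show ?case
    using M_carrier by (simp del: M_carrier add: carrier_matD[of M n n])
next
  case (Suc m)
  have "lowered m f i = lowered (Suc m) f i \<or> lowered m f i = lowered (Suc m) f i + 1" for i
    by (auto simp: lowered_def max_def)
  then show ?case
    using f Suc by (intro M_pow_pos_step[where h = "lowered m f"] M_pos_down increasing_index_lowered)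
qed

text \<open>The path from \<open>f\<close> to \<open>g\<close> leads through the least index \<open>0, 1, \<dots>, k - 1\<close>.\<close>

lemma M_pow_pos:
  assumes f: "increasing_index k n f" and g: "increasing_index k n g"
  shows "0 < minor (M ^\<^sub>m (n + n)) k f g"
proof -
  \<comment> \<open>The first \<open>n\<close> factors bring \<open>f\<close> down to the least
    index; the other \<open>m\<close> retrace the descent of \<open>g\<close> upwards and arrive at
    \<open>g\<close> when \<open>m = n\<close>.\<close>
  have "0 < minor (M ^\<^sub>m (n + m)) k f (lowered (n - m) g)" if "m \<le> n" for m
    using that
  proof (induction m)
    case 0
    \<comment> \<open>All values are below \<open>n\<close>, so \<open>n\<close> downward steps take
      both \<open>f\<close> and \<open>g\<close> to the least index.\<close>
    have "minor (M ^\<^sub>m n) k f (lowered n f) = minor (M ^\<^sub>m n) k f (lowered n g)"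
      using increasing_index_less[OF f] increasing_index_less[OF g]
      by (intro minor_cong) (auto simp: lowered_def less_imp_le)
    then show ?case using M_pow_pos_lowered[OF f, of n] by simp
  next
    case (Suc m)
    have "lowered (n - Suc m) g i = lowered (n - m) g i \<or>
        lowered (n - Suc m) g i = lowered (n - m) g i + 1" for i
      using Suc.prems by (auto simp: lowered_def max_def)
    then have "0 < minor (M ^\<^sub>m Suc (n + m)) k f (lowered (n - Suc m) g)"
      using f g Suc
      by (intro M_pow_pos_step[where h = "lowered (n - m) g"] M_pos_up increasing_index_lowered) auto
    then show ?case by simp
  qed
  from this[of n] have "0 < minor (M ^\<^sub>m (n + n)) k f (lowered 0 g)" by simp
  also have "minor (M ^\<^sub>m (n + n)) k f (lowered 0 g) = minor (M ^\<^sub>m (n + n)) k f g"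
    using increasing_index_ge[OF g] by (intro minor_cong) (auto simp: lowered_def)
  finally show ?thesis .
qed

lemma oscillatory_M:
  assumes "1 \<le> n"
  shows "oscillatory_mat M"
  unfolding oscillatory_mat_def
proof (intro conjI exI)
  show "square_mat M" using M_carrier by (simp del: M_carrier)
  show "totally_nonnegative M"
    unfolding totally_nonnegative_def by (intro all_minorsI[of _ n] M_carrier M_nonneg)
  show "totally_positive (M ^\<^sub>m (n + n))"
    unfolding totally_positive_def
    by (intro all_minorsI[of _ n] pow_carrier_mat M_carrier M_pow_pos)
  show "1 \<le> n + n" using assms by simp
qed

end

section \<open>Finite sections of semi-infinite products\<close>

lemma semi_inf_times_lower:
  assumes lower: "\<And>i k. i < k \<Longrightarrow> A i k = 0" and "i < n"
  shows "semi_inf_times A B i j = (\<Sum>k=0..<n. A i k * B k j)"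
  unfolding semi_inf_times_def
  by (rule Sum_any.expand_superset) (use assms in \<open>auto intro: ccontr\<close>)

text \<open>The first \<open>n\<close> rows of a lower triangular left factor vanish from column
  \<open>n\<close> on, so the rows of \<open>B\<close> that are cut off never contribute.\<close>

lemma leading_principal_semi_inf_times:
  assumes lower: "\<And>i k. i < k \<Longrightarrow> A i k = 0"
  shows "leading_principal (semi_inf_times A B) n = leading_principal A n * leading_principal B n"
  by (rule eq_matI)
     (auto simp: leading_principal_def scalar_prod_def semi_inf_times_lower[OF lower] intro!: sum.cong)

text \<open>With this, the product of the two lower bidiagonal factors can again serve as the left
  factor in \<open>leading_principal_semi_inf_times\<close>.\<close>

lemma lower_semi_inf_times:
  assumes A: "\<And>i k. i < k \<Longrightarrow> A i k = 0" and B: "\<And>i k. i < k \<Longrightarrow> B i k = 0" and "i < j"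
  shows "semi_inf_times A B i j = 0"
proof -
  have "A i k * B k j = 0" for k
    using A[of i k] B[of k j] \<open>i < j\<close> by (cases "i < k") auto
  then show ?thesis by (simp add: semi_inf_times_def del: mult_eq_0_iff)
qed

lemma oscillatory_if_admits_PBF:
  assumes "admits_PBF T"
  shows "oscillatory T"
  unfolding oscillatory_def
proof (intro allI impI)
  fix n :: nat assume n: "1 \<le> n"
  obtain \<alpha> where pos: "\<forall>j\<ge>1. 0 < \<alpha> j" and T: "T = semi_inf_times
           (semi_inf_times (lower_unitri_bidiag (\<lambda>k. \<alpha> (3 * k + 2)))
                           (lower_unitri_bidiag (\<lambda>k. \<alpha> (3 * k + 3))))
           (upper_bidiag (\<lambda>k. \<alpha> (3 * k + 1)))"
    using assms by (auto simp: admits_PBF_def is_PBF_def)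
  interpret positive_bidiagonals "\<lambda>k. \<alpha> (3 * k + 2)" "\<lambda>k. \<alpha> (3 * k + 3)" "\<lambda>k. \<alpha> (3 * k + 1)" n
    using pos by unfold_locales auto
  have lower: "i < k \<Longrightarrow> lower_unitri_bidiag s i k = 0" for s i k
    by (simp add: lower_unitri_bidiag_def)
  have "leading_principal T n = M"
    unfolding T M_def
    by (simp add: leading_principal_semi_inf_times lower_semi_inf_times lower)
  then show "oscillatory_mat (leading_principal T n)"
    using oscillatory_M[OF n] by simp
qed

section \<open>Determinants of tetradiagonal Toeplitz matrices\<close>

text \<open>Log-concavity makes the ratios nonincreasing, and positivity bounds them below by 0.
  Their limit is therefore their infimum, which gives the last conclusion.\<close>

lemma log_concave_tendsto_ratio:
  fixes D :: "nat \<Rightarrow> real"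
  assumes pos: "\<And>n. 0 < D n" and lc: "\<And>n. D n * D (n + 2) \<le> (D (n + 1))\<^sup>2"
  obtains u where "0 \<le> u" "(\<lambda>n. D (n + 1) / D n) \<longlonglongrightarrow> u" "\<And>n. u * D n \<le> D (n + 1)"
proof -
  let ?x = "\<lambda>n. D (n + 1) / D n"
  have "decseq ?x"
  proof (rule decseq_SucI)
    fix n
    show "?x (Suc n) \<le> ?x n"
      using lc[of n] pos[of n] pos[of "n + 1"] by (simp add: field_simps power2_eq_square)
  qed
  moreover have "bdd_below (range ?x)"
    using pos by (auto intro!: bdd_belowI[of _ 0] divide_nonneg_nonneg less_imp_le)
  ultimately have lim: "?x \<longlonglongrightarrow> (INF n. ?x n)" and le: "(INF n. ?x n) \<le> ?x n" for n
    by (auto intro: LIMSEQ_decseq_INF cINF_lower)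
  show thesis
  proof (rule that[OF _ lim])
    show "0 \<le> (INF n. ?x n)"
      using pos by (intro cINF_greatest) (auto intro: less_imp_le)
    show "(INF n. ?x n) * D n \<le> D (n + 1)" for n
      using le[of n] pos[of n] by (simp add: field_simps)
  qed
qed

text \<open>Dividing the recurrence by \<open>D n\<close> expresses it in products of consecutive
  ratios, each of which tends to \<open>u\<close>.\<close>

lemma ratio_limit_root:
  fixes D :: "nat \<Rightarrow> real"
  assumes pos: "\<And>n. 0 < D n"
    and rec: "\<And>n. D (n + 3) = c * D (n + 2) - b * D (n + 1) + a * D n"
    and lim: "(\<lambda>n. D (n + 1) / D n) \<longlonglongrightarrow> u"
  shows "u ^ 3 = c * u\<^sup>2 - b * u + a"
proof -
  define x where "x n = D (n + 1) / D n" for n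
  have x: "x \<longlonglongrightarrow> u" using lim by (simp add: x_def[abs_def])
  have x1: "(\<lambda>n. x (n + 1)) \<longlonglongrightarrow> u" by (rule LIMSEQ_ignore_initial_segment[OF x])
  have x2: "(\<lambda>n. x (n + 2)) \<longlonglongrightarrow> u" by (rule LIMSEQ_ignore_initial_segment[OF x])
  have "x (n + 2) * x (n + 1) * x n = c * (x (n + 1) * x n) - b * x n + a" for n
  proof -
    have 1: "x (n + 1) * x n = D (n + 2) / D n"
      using pos[of "n + 1"] by (simp add: x_def less_imp_neq[symmetric])
    have 2: "x (n + 2) * x (n + 1) * x n = D (n + 3) / D n"
      using pos[of "n + 2"] unfolding mult.assoc 1
      by (simp add: x_def less_imp_neq[symmetric] numeral_3_eq_3)
    show ?thesis
      unfolding 1 2 rec using pos[of n] by (simp add: x_def add_divide_distrib diff_divide_distrib)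
  qed
  then have "(\<lambda>n. c * (x (n + 1) * x n) - b * x n + a) \<longlonglongrightarrow> u * u * u"
    using tendsto_mult[OF tendsto_mult[OF x2 x1] x] by simp
  moreover have "(\<lambda>n. c * (x (n + 1) * x n) - b * x n + a) \<longlonglongrightarrow> c * (u * u) - b * u + a"
    by (intro tendsto_intros x x1)
  ultimately have "u * u * u = c * (u * u) - b * u + a" by (rule LIMSEQ_unique)
  then show ?thesis by (simp add: power2_eq_square power3_eq_cube)
qed

text \<open>These are the complete homogeneous symmetric polynomials in the roots of
  \<open>x^3 - c x^2 + b x - a\<close>.\<close>

fun toeplitz_det :: "real \<Rightarrow> real \<Rightarrow> real \<Rightarrow> nat \<Rightarrow> real" where
  "toeplitz_det a b c 0 = 1"
| "toeplitz_det a b c (Suc 0) = c"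
| "toeplitz_det a b c (Suc (Suc 0)) = c\<^sup>2 - b"
| "toeplitz_det a b c (Suc (Suc (Suc n))) = c * toeplitz_det a b c (Suc (Suc n))
    - b * toeplitz_det a b c (Suc n) + a * toeplitz_det a b c n"

text \<open>The right-hand side belongs to the pairwise products of the roots, whose elementary
  symmetric functions are \<open>b\<close>, \<open>a * c\<close> and \<open>a^2\<close>. Both sides
  obey the same recurrence of order three, hence the three base cases.\<close>

lemma toeplitz_det_log_concave:
  "(toeplitz_det a b c (Suc n))\<^sup>2 - toeplitz_det a b c n * toeplitz_det a b c (Suc (Suc n))
    = toeplitz_det (a\<^sup>2) (a * c) b (Suc n)"
proof (induction n rule: less_induct)
  case (less n)
  consider "n = 0" | "n = 1" | "n = 2" | m where "n = Suc (Suc (Suc m))"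
    by (metis One_nat_def Suc_1 not0_implies_Suc)
  then show ?case
  proof cases
    case 4
    have "m < n" "Suc m < n" "Suc (Suc m) < n" using 4 by auto
    note e = this[THEN less, symmetric]
    show ?thesis
      unfolding 4 toeplitz_det.simps(4)[of "a\<^sup>2" "a * c" b "Suc m"] e
      by (simp add: algebra_simps power2_eq_square)
  qed (auto simp: numeral_eq_Suc algebra_simps)
qed

text \<open>The parameters run from the superdiagonal downwards. The superdiagonal is left general
  because a transposed minor of \<open>T\<close> has \<open>a\<close> there.\<close>

definition toeplitz_mat :: "real \<Rightarrow> real \<Rightarrow> real \<Rightarrow> real \<Rightarrow> nat \<Rightarrow> real mat" where
  "toeplitz_mat d c b a n = mat n n (\<lambda>(i, j).
     if j = i + 1 then d else if i = j then c else if i = j + 1 then b else if i = j + 2 then a else 0)"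

lemma toeplitz_mat_carrier [simp]: "toeplitz_mat d c b a n \<in> carrier_mat n n"
  by (simp add: toeplitz_mat_def)

lemma det_first_row:
  assumes A: "(A :: 'a :: comm_ring_1 mat) \<in> carrier_mat (Suc (Suc n)) (Suc (Suc n))"
    and zero: "\<And>j. 2 \<le> j \<Longrightarrow> j < Suc (Suc n) \<Longrightarrow> A $$ (0, j) = 0"
  shows "det A = A $$ (0, 0) * det (mat_delete A 0 0) - A $$ (0, 1) * det (mat_delete A 0 1)"
proof -
  have "det A = (\<Sum>j<Suc (Suc n). A $$ (0, j) * cofactor A 0 j)"
    by (rule laplace_expansion_row[OF A]) simp
  also have "\<dots> = (\<Sum>j\<in>{0, 1}. A $$ (0, j) * cofactor A 0 j)"
    by (rule sum.mono_neutral_right) (auto simp: zero)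
  finally show ?thesis by (simp add: cofactor_def)
qed

lemma mat_delete_first [simp]:
  "mat_delete (toeplitz_mat d c b a (Suc n)) 0 0 = toeplitz_mat d c b a n"
  by (rule eq_matI) (auto simp: toeplitz_mat_def mat_delete_def insert_index_def)

text \<open>Two expansions along the first row lead to \<open>?B\<close>, with first column
  \<open>b, a, 0, ...\<close>, and \<open>?C\<close>, with first column \<open>a, 0, ...\<close>.
  Expanding \<open>?C\<close> along that column leads back to a Toeplitz matrix.\<close>

lemma det_toeplitz_mat_rec:
  "det (toeplitz_mat d c b a (n + 3)) = c * det (toeplitz_mat d c b a (n + 2))
    - d * b * det (toeplitz_mat d c b a (n + 1)) + d\<^sup>2 * a * det (toeplitz_mat d c b a n)"
proof -
  let ?T = "toeplitz_mat d c b a"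
  let ?B = "mat_delete (?T (n + 3)) 0 1"
  let ?C = "mat_delete ?B 0 1"
  have B: "?B \<in> carrier_mat (Suc (Suc n)) (Suc (Suc n))"
    by (simp add: mat_delete_def toeplitz_mat_def)
  have C: "?C \<in> carrier_mat (Suc n) (Suc n)"
    by (simp add: mat_delete_def toeplitz_mat_def)
  have C_det: "det ?C = a * det (?T n)"
  proof -
    have "det ?C = (\<Sum>i<Suc n. ?C $$ (i, 0) * cofactor ?C i 0)"
      by (rule laplace_expansion_column[OF C]) simp
    also have "\<dots> = (\<Sum>i\<in>{0}. ?C $$ (i, 0) * cofactor ?C i 0)"
      by (rule sum.mono_neutral_right) (auto simp: toeplitz_mat_def mat_delete_def)
    finally have "det ?C = ?C $$ (0, 0) * det (mat_delete ?C 0 0)" by (simp add: cofactor_def)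
    moreover have "?C $$ (0, 0) = a"
      by (simp add: toeplitz_mat_def mat_delete_def)
    moreover have "mat_delete ?C 0 0 = ?T n"
      by (rule eq_matI) (auto simp: toeplitz_mat_def mat_delete_def)
    ultimately show ?thesis by simp
  qed
  have BB: "mat_delete ?B 0 0 = ?T (n + 1)" 
    by (rule eq_matI) (auto simp: toeplitz_mat_def mat_delete_def)
  have B_det: "det ?B = b * det (?T (n + 1)) - d * det ?C"
  proof -
    have "det ?B = ?B $$ (0, 0) * det (mat_delete ?B 0 0) - ?B $$ (0, 1) * det ?C"
      by (rule det_first_row[OF B]) (auto simp: toeplitz_mat_def mat_delete_def)
    moreover have "?B $$ (0, 0) = b" "?B $$ (0, 1) = d"
      by (auto simp: toeplitz_mat_def mat_delete_def)
    ultimately show ?thesis unfolding BB by simp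
  qed
  have "det (?T (n + 3)) = c * det (?T (n + 2)) - d * det ?B"
  proof -
    have "?T (n + 3) \<in> carrier_mat (Suc (Suc (Suc n))) (Suc (Suc (Suc n)))"
      using toeplitz_mat_carrier[of d c b a "n + 3"] by (simp add: numeral_3_eq_3)
    from det_first_row[OF this] have "det (?T (n + 3)) = ?T (n + 3) $$ (0, 0) * det (mat_delete (?T (n + 3)) 0 0)
        - ?T (n + 3) $$ (0, 1) * det ?B"
      by (simp add: toeplitz_mat_def)
    moreover have "mat_delete (?T (n + 3)) 0 0 = ?T (n + 2)"
      using mat_delete_first[of d c b a "n + 2"] by (simp add: eval_nat_numeral)
    ultimately show ?thesis by (simp add: toeplitz_mat_def)
  qed
  then show ?thesis unfolding B_det C_det by (simp add: algebra_simps power2_eq_square)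
qed

text \<open>In the recurrence \<open>b\<close> always comes with one factor \<open>d\<close> and
  \<open>a\<close> with two, so \<open>d\<close> is absorbed into these coefficients.\<close>

lemma det_toeplitz_mat: "det (toeplitz_mat d c b a n) = toeplitz_det (d\<^sup>2 * a) (d * b) c n"
proof (induction n rule: less_induct)
  case (less n)
  consider "n = 0" | "n = 1" | "n = 2" | m where "n = m + 3"
    by (metis One_nat_def Suc_1 add.commute add_Suc not0_implies_Suc numeral_3_eq_3 plus_nat.add_0)
  then show ?case
  proof cases
    case 1
    then show ?thesis by (simp add: toeplitz_mat_def)
  next
    case 2
    then show ?thesis by (simp add: toeplitz_mat_def det_single)
  next
    case 3
    let ?T = "toeplitz_mat d c b a (Suc (Suc 0))"
    have "det ?T = ?T $$ (0, 0) * det (mat_delete ?T 0 0) - ?T $$ (0, 1) * det (mat_delete ?T 0 1)"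
      by (rule det_first_row[of _ 0]) auto
    moreover have "det (mat_delete ?T 0 0) = c" "det (mat_delete ?T 0 1) = b"
      by (subst det_single; simp add: toeplitz_mat_def mat_delete_def)+
    ultimately show ?thesis
      using 3 by (simp add: toeplitz_mat_def power2_eq_square numeral_2_eq_2)
  next
    case 4
    then show ?thesis
      using less by (simp add: det_toeplitz_mat_rec) (simp add: eval_nat_numeral)
  qed
qed

text \<open>The determinant is itself a minor, hence nonnegative. It cannot vanish, because its
  power with some exponent \<open>k \<ge> 1\<close> is the determinant of a totally positive
  matrix.\<close>

lemma oscillatory_mat_det_pos:
  assumes "oscillatory_mat A" and A: "A \<in> carrier_mat n n" and "1 \<le> n"
  shows "0 < det A"
proof -
  have id: "increasing_index n n (\<lambda>i. i)"
    by (auto simp: increasing_index_def strict_mono_on_def)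
  have minor: "minor B n (\<lambda>i. i) (\<lambda>i. i) = det B" if "B \<in> carrier_mat n n" for B :: "real mat"
    unfolding minor_def by (rule arg_cong[where f = det], rule eq_matI) (use that in auto)
  obtain k where "1 \<le> k" and tp: "totally_positive (A ^\<^sub>m k)" and tn: "totally_nonnegative A"
    using assms(1) by (auto simp: oscillatory_mat_def)
  have Ak: "A ^\<^sub>m k \<in> carrier_mat n n" using A by (rule pow_carrier_mat)
  have "0 < det (A ^\<^sub>m k)"
    using all_minorsD[OF tp[unfolded totally_positive_def] Ak _ id id] minor[OF Ak] \<open>1 \<le> n\<close> by simp
  moreover have "det (A ^\<^sub>m k) = det A ^ k" for k
  proof (induction k)
    case 0
    then show ?case using A by simp
  next
    case (Suc k)
    then show ?case using A by (simp add: det_mult[of _ n] pow_carrier_mat)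
  qed
  ultimately have "det A \<noteq> 0" using \<open>1 \<le> k\<close> by (auto simp: power_0_left)
  moreover have "0 \<le> det A"
    using all_minorsD[OF tn[unfolded totally_nonnegative_def] A _ id id] minor[OF A] \<open>1 \<le> n\<close> by simp
  ultimately show ?thesis by simp
qed

section \<open>Factorization of tetradiagonal Toeplitz matrices\<close>

lemma semi_inf_times_lower_bidiag:
  "semi_inf_times (lower_unitri_bidiag s) B i j
    = B i j + (if i = 0 then 0 else s (i - 1) * B (i - 1) j)"
proof -
  have "semi_inf_times (lower_unitri_bidiag s) B i j
      = (\<Sum>k\<in>{i - 1, i}. lower_unitri_bidiag s i k * B k j)"
    unfolding semi_inf_times_def
    by (rule Sum_any.expand_superset) (auto simp: lower_unitri_bidiag_def split: if_splits)
  then show ?thesis by (cases i) (auto simp: lower_unitri_bidiag_def)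
qed

lemma semi_inf_times_upper_bidiag:
  "semi_inf_times A (upper_bidiag d) i j
    = A i j * d j + (if j = 0 then 0 else A i (j - 1))"
proof -
  have "semi_inf_times A (upper_bidiag d) i j
      = (\<Sum>k\<in>{j - 1, j}. A i k * upper_bidiag d k j)"
    unfolding semi_inf_times_def
    by (rule Sum_any.expand_superset) (auto simp: upper_bidiag_def split: if_splits)
  then show ?thesis by (cases j) (auto simp: upper_bidiag_def)
qed

text \<open>If \<open>r\<close>, \<open>r1\<close>, \<open>r2\<close> are the roots of the cubic, then \<open>g k\<close> and \<open>h k\<close> are the complete homogeneous
  symmetric polynomials of degree \<open>k\<close> in \<open>r1, r2\<close> and in \<open>r, r1, r2\<close>.\<close>

lemma admits_PBF_tetradiag_toeplitz:
  fixes r p q :: real and g h :: "nat \<Rightarrow> real"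
  assumes "0 < r" "0 < p" and g_pos: "\<And>k. 0 < g k" and h_pos: "\<And>k. 0 < h k"
    and g: "g 0 = 1" "g 1 = q" "\<And>k. g (k + 2) = q * g (k + 1) - p * g k"
    and h: "h 0 = 1" "\<And>k. h (k + 1) = g (k + 1) + r * h k"
  shows "admits_PBF (tetradiag_toeplitz (r * p) (r * q + p) (r + q))"
proof -
  \<comment> \<open>As in an LU factorization, \<open>d\<close> consists of quotients of consecutive
    leading principal minors. The choice of \<open>t\<close> gives
    \<open>t k * d k = r * g (k + 2) / g (k + 1)\<close>, whose product with
    \<open>s (k + 1)\<close> cancels to \<open>r * p\<close>.\<close>
  define d where "d k = h (k + 1) / h k" for k
  define s where "s k = p * g k / g (k + 1)" for k
  define t where "t k = r * g (k + 2) * h k / (g (k + 1) * h (k + 1))" for k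
  \<comment> \<open>The three sequences are interleaved from index 1 on; by truncated subtraction
    the value at 0 is \<open>d 0\<close>.\<close>
  define \<alpha> where "\<alpha> j = (let k = (j - 1) div 3 in
      if (j - 1) mod 3 = 0 then d k else if (j - 1) mod 3 = 1 then s k else t k)" for j
  have \<alpha>_simps: "(\<lambda>k. \<alpha> (3 * k + 1)) = d" "(\<lambda>k. \<alpha> (3 * k + 2)) = s" "(\<lambda>k. \<alpha> (3 * k + 3)) = t"
  proof -
    have "Suc (3 * k) div 3 = k" "Suc (3 * k) mod 3 = 1"
      "Suc (Suc (3 * k)) div 3 = k" "Suc (Suc (3 * k)) mod 3 = 2" for k
      by presburger+
    then show "(\<lambda>k. \<alpha> (3 * k + 1)) = d" "(\<lambda>k. \<alpha> (3 * k + 2)) = s" "(\<lambda>k. \<alpha> (3 * k + 3)) = t"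
      by (auto simp: \<alpha>_def fun_eq_iff Let_def)
  qed
  have pos: "0 < d k" "0 < s k" "0 < t k" for k
    using \<open>0 < r\<close> \<open>0 < p\<close> g_pos h_pos by (auto simp: d_def s_def t_def)
  have nz [simp]: "g k \<noteq> 0" "h k \<noteq> 0" for k
    using g_pos[of k] h_pos[of k] by auto
  have g': "g (Suc (Suc k)) = q * g (Suc k) - p * g k" for k
    using g(3)[of k] by simp
  have h': "h (Suc k) = g (Suc k) + r * h k" for k
    using h(2)[of k] by simp
  have h'': "h (Suc (Suc k)) = q * g (Suc k) - p * g k + r * (g (Suc k) + r * h k)" for k
    using h'[of "Suc k"] h'[of k] g'[of k] by simp
  \<comment> \<open>Column 0 of the product receives only the diagonal term of
    \<open>upper_bidiag\<close>, hence the boundary cases \<open>diag0\<close> and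
    \<open>sub0\<close>.\<close>
  have diag0: "d 0 = r + q"
    using g h by (simp add: d_def)
  have diag: "d (Suc k) + s k + t k = r + q" for k
  proof -
    have "(d (Suc k) + s k + t k) * (g (Suc k) * h (Suc k))
        = h (Suc (Suc k)) * g (Suc k) + p * g k * h (Suc k) + r * g (Suc (Suc k)) * h k"
      by (simp add: d_def s_def t_def field_simps)
    \<comment> \<open>Once denominators are cleared, the recurrences turn both sides into
      polynomials in \<open>g k\<close>, \<open>g (Suc k)\<close> and \<open>h k\<close>.\<close>
    also have "\<dots> = (r + q) * (g (Suc k) * h (Suc k))"
      unfolding h'' h' g' by (simp add: algebra_simps)
    finally show ?thesis by simp
  qed
  have sub0: "(s 0 + t 0) * d 0 = r * q + p"
  proof -
    have "((s 0 + t 0) * d 0) * g 1 = p * h 1 + r * g 2"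
      by (simp add: d_def s_def t_def field_simps g(1) h(1) numeral_2_eq_2)
    also have "\<dots> = (r * q + p) * g 1"
    proof -
      have g2: "g 2 = q * q - p" and h1: "h 1 = q + r"
        using g(3)[of 0] h(2)[of 0] by (simp_all add: g(1,2)[unfolded One_nat_def] h(1) numeral_2_eq_2)
      show ?thesis unfolding g2 h1 g(2) by (simp add: algebra_simps)
    qed
    finally show ?thesis using nz(1)[of 1] by simp
  qed
  have sub: "(s (Suc k) + t (Suc k)) * d (Suc k) + s (Suc k) * t k = r * q + p" for k
  proof -
    have "((s (Suc k) + t (Suc k)) * d (Suc k) + s (Suc k) * t k) * (g (Suc (Suc k)) * h (Suc k))
        = p * g (Suc k) * h (Suc (Suc k)) + r * g (Suc (Suc (Suc k))) * h (Suc k)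
          + p * r * g (Suc (Suc k)) * h k"
      by (simp add: d_def s_def t_def field_simps)
    also have "\<dots> = (r * q + p) * (g (Suc (Suc k)) * h (Suc k))"
      unfolding h'' h' g' by (simp add: algebra_simps)
    finally show ?thesis by simp
  qed
  have subsub: "s (Suc k) * t k * d k = r * p" for k
    by (simp add: d_def s_def t_def field_simps)
  define L where "L i j = (if i = j then 1 else if i = j + 1 then s j + t j
      else if i = j + 2 then s (Suc j) * t j else 0)" for i j
  have L: "semi_inf_times (lower_unitri_bidiag s) (lower_unitri_bidiag t) = L"
  proof (intro ext)
    show "semi_inf_times (lower_unitri_bidiag s) (lower_unitri_bidiag t) i j = L i j" for i j
      unfolding semi_inf_times_lower_bidiag by (cases i) (auto simp: lower_unitri_bidiag_def L_def)
  qed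
  have "tetradiag_toeplitz (r * p) (r * q + p) (r + q) i j
      = semi_inf_times (semi_inf_times (lower_unitri_bidiag s) (lower_unitri_bidiag t)) (upper_bidiag d) i j"
    for i j
  proof -
    note simps = L semi_inf_times_upper_bidiag L_def tetradiag_toeplitz_def
    consider "j = i + 1" | "i = 0" "j = 0" | k where "i = Suc k" "j = Suc k"
      | "i = 1" "j = 0" | k where "i = Suc (Suc k)" "j = Suc k" | k where "i = Suc (Suc k)" "j = k"
      | "j > i + 1 \<or> i > j + 2"
      by (cases i; cases j) (force simp: not_less less_Suc_eq_le le_Suc_eq)+
    then show ?thesis
    proof cases
      case 2
      then show ?thesis using diag0 by (simp add: simps)
    next
      case (3 k)
      then show ?thesis using diag[of k] by (simp add: simps)
    next
      case 4
      then show ?thesis using sub0 by (simp add: simps)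
    next
      case (5 k)
      then show ?thesis using sub[of k] by (simp add: simps)
    next
      case (6 k)
      then show ?thesis using subsub[of k] by (cases k) (simp_all add: simps)
    next
      case 1
      then show ?thesis by (simp add: simps)
    next
      case 7
      then show ?thesis by (cases j) (auto simp: simps)
    qed
  qed
  moreover have "0 < \<alpha> j" for j
    using pos by (auto simp: \<alpha>_def Let_def)
  ultimately have "is_PBF \<alpha> (tetradiag_toeplitz (r * p) (r * q + p) (r + q))"
    unfolding is_PBF_def \<alpha>_simps by (auto simp: fun_eq_iff)
  then show ?thesis by (auto simp: admits_PBF_def)
qed

section \<open>From oscillatory to factorized Toeplitz matrices\<close>

lemma leading_principal_tetradiag_toeplitz:
  "leading_principal (tetradiag_toeplitz a b c) n = toeplitz_mat 1 c b a n"
  by (rule eq_matI) (auto simp: leading_principal_def tetradiag_toeplitz_def toeplitz_mat_def)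

lemma toeplitz_det_pos:
  assumes "oscillatory (tetradiag_toeplitz a b c)"
  shows "0 < toeplitz_det a b c n"
proof (cases n)
  case (Suc m)
  then have "0 < det (toeplitz_mat 1 c b a n)"
    using assms oscillatory_mat_det_pos[of "toeplitz_mat 1 c b a n" n]
    by (simp add: oscillatory_def leading_principal_tetradiag_toeplitz)
  then show ?thesis by (simp add: det_toeplitz_mat)
qed simp

text \<open>The transpose of the matrix without its first row is again Hessenberg and Toeplitz.\<close>

lemma toeplitz_det_sub_nonneg:
  assumes "oscillatory (tetradiag_toeplitz a b c)"
  shows "0 \<le> toeplitz_det (a\<^sup>2) (a * c) b (Suc n)"
proof -
  let ?n = "Suc n" and ?A = "leading_principal (tetradiag_toeplitz a b c) (Suc (Suc n))"
  have tn: "totally_nonnegative ?A"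
    using assms by (auto simp: oscillatory_def oscillatory_mat_def)
  have "0 \<le> minor ?A ?n Suc (\<lambda>i. i)"
    using tn unfolding totally_nonnegative_def
    by (rule all_minorsD[of _ _ "Suc (Suc n)"])
       (auto simp: increasing_index_def strict_mono_on_def leading_principal_def)
  also have "minor ?A ?n Suc (\<lambda>i. i) = det (transpose_mat (toeplitz_mat a b c 1 ?n))"
    unfolding minor_def
    by (rule arg_cong[where f = det], rule eq_matI)
       (auto simp: leading_principal_def tetradiag_toeplitz_def toeplitz_mat_def)
  also have "\<dots> = toeplitz_det (a\<^sup>2) (a * c) b ?n"
    by (simp add: det_transpose[of _ ?n] det_toeplitz_mat)
  finally show ?thesis .
qed

lemma admits_PBF_if_oscillatory:
  assumes "0 < a" and osc: "oscillatory (tetradiag_toeplitz a b c)"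
  shows "admits_PBF (tetradiag_toeplitz a b c)"
proof -
  let ?h = "toeplitz_det a b c"
  note h_pos = toeplitz_det_pos[OF osc]
  have rec: "?h (n + 3) = c * ?h (n + 2) - b * ?h (n + 1) + a * ?h n" for n
    by (simp add: eval_nat_numeral)
  have lc: "?h n * ?h (n + 2) \<le> (?h (n + 1))\<^sup>2" for n
    using toeplitz_det_sub_nonneg[OF osc, of n] toeplitz_det_log_concave[of a b c n] by simp
  obtain r where "0 \<le> r" and lim: "(\<lambda>n. ?h (n + 1) / ?h n) \<longlonglongrightarrow> r"
    and r: "\<And>n. r * ?h n \<le> ?h (n + 1)"
    using log_concave_tendsto_ratio[OF h_pos lc] by blast
  have root: "r ^ 3 = c * r\<^sup>2 - b * r + a"
    by (rule ratio_limit_root[OF h_pos rec lim])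
  \<comment> \<open>A root at 0 would force \<open>a = 0\<close>.\<close>
  with \<open>0 < a\<close> \<open>0 \<le> r\<close> have "0 < r" by (cases "r = 0") auto
  \<comment> \<open>The sum and the product of the other two roots.\<close>
  define q p where "q = c - r" and "p = a / r"
  have "0 < p" using \<open>0 < a\<close> \<open>0 < r\<close> by (simp add: p_def)
  have a: "a = r * p" and c: "c = r + q"
    using \<open>0 < r\<close> by (auto simp: p_def q_def)
  have "r * b = r * (r * q + p)"
    using root unfolding a c by (simp add: algebra_simps power2_eq_square power3_eq_cube)
  then have b: "b = r * q + p" using \<open>0 < r\<close> by simp
  \<comment> \<open>Subtracting \<open>r\<close> times the preceding value removes the root
    \<open>r\<close> from the recurrence. The value at 0 fits the convention that \<open>?h\<close>
    is 0 at -1.\<close>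
  define g where "g n = (if n = 0 then 1 else ?h n - r * ?h (n - 1))" for n
  have g: "g 0 = 1" "g 1 = q" by (auto simp: g_def c)
  have g_rec: "g (n + 2) = q * g (n + 1) - p * g n" for n
  proof (cases n)
    case 0
    then show ?thesis by (simp add: g_def a b c numeral_2_eq_2 algebra_simps power2_eq_square)
  next
    case (Suc m)
    have "?h (Suc (Suc (Suc m))) = (r + q) * ?h (Suc (Suc m)) - (r * q + p) * ?h (Suc m) + r * p * ?h m"
      using rec[of m] unfolding a[symmetric] b[symmetric] c[symmetric] by (simp add: eval_nat_numeral)
    then show ?thesis unfolding Suc by (simp add: g_def algebra_simps del: toeplitz_det.simps)
  qed
  have g_nonneg: "0 \<le> g n" for n
    using r[of "n - 1"] by (cases n) (auto simp: g_def)
  have g_pos: "0 < g n" for n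
  proof (induction n)
    case (Suc n)
    have "g (Suc n) \<noteq> 0"
    proof
      assume "g (Suc n) = 0"
      \<comment> \<open>A zero right after a positive value would be followed by a negative
        one.\<close>
      then have "g (n + 2) = - (p * g n)" using g_rec[of n] by simp
      with Suc \<open>0 < p\<close> g_nonneg[of "n + 2"] mult_pos_pos[of p "g n"] show False by linarith
    qed
    with g_nonneg[of "Suc n"] show ?case by simp
  qed (simp add: g)
  show ?thesis
    using admits_PBF_tetradiag_toeplitz[of r p g ?h q] \<open>0 < r\<close> \<open>0 < p\<close> g_pos h_pos g g_rec
    by (simp add: g_def a b c)
qed

theorem theorem10:
  fixes a b c :: real
  assumes "a > 0" and "b \<ge> 0" and "c \<ge> 0"
  shows "oscillatory (tetradiag_toeplitz a b c) \<longleftrightarrow> admits_PBF (tetradiag_toeplitz a b c)"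
  using admits_PBF_if_oscillatory[OF assms(1)] oscillatory_if_admits_PBF by blast

end
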